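(* Let $X$ and $Z$ be Hausdorff topological vector spaces, let $C\subseteq Z$ be a convex and pointed cone with nonempty interior, and let $K$ be a nonempty, convex subset of $X$. Consider a mapping $F:K\times K\times K\to Z$ satisfying: (i) for every $y\in K$, one of the following conditions is satisfied: (a) for every net $(x_\alpha)\subseteq K$ with $\lim x_\alpha=x\in K$: if $F(x_\alpha,y,x_\alpha)\notin-\operatorname{int}C$ for all $\alpha$, then $F(x,y,x)\notin-\operatorname{int}C$; (b) the mapping $x\mapsto F(x,y,x)$ is $C$-upper semicontinuous on $K$; (c) for every $x\in K$ and every net $(x_\alpha)\subseteq K$ with $\lim x_\alpha=x$ there exists a net $(z_\alpha)\subseteq Z$ with $\lim z_\alpha=z$ such that $F(x_\alpha,y,x_\alpha)-z_\alpha\in-C$ and $F(x,y,x)-z\in C$; (ii) for every $x\in K$, the mapping $y\mapsto F(x,y,x)$ is $C$-convex; (iii) for every $x\in K$, $F(x,x,x)\in(-C)\setminus(-\operatorname{int}C)$; (iv) there exists a nonempty compact convex subset $K_0$ of $K$ with the property that for every $x\in K_0\setminus\operatorname{core}_K K_0$ there exists $y_0\in\operatorname{core}_K K_0$ such that $F(x,y_0,x)\in-C$. Then there exists an element $x_0\in K$ such that $F(x_0,y,x_0)\notin-\operatorname{int}C$ for all $y\in K$.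
   Context: All spaces are real. A cone $C$ satisfies $tc\in C$ for all $c\in C$, $t\ge 0$; it is convex if $C+C=C$ and pointed if $C\cap(-C)=\{0\}$ ($C$ is not assumed closed). $\operatorname{int}C$ is the interior of $C$. A map $f:K\to Z$ is $C$-upper semicontinuous at $x\in K$ if for any neighborhood $V$ of $f(x)$ there exists a neighborhood $U$ of $x$ such that $f(u)\in V-C$ for all $u\in U\cap K$; it is $C$-upper semicontinuous on $K$ if this holds at every $x\in K$. A map $f:K\to Z$ ($K$ convex) is $C$-convex if $tf(x)+(1-t)f(y)-f(tx+(1-t)y)\in C$ for all $x,y\in K$, $t\in[0,1]$. For convex sets $U\subseteq V\subseteq X$, the algebraic interior of $U$ relative to $V$ is $\operatorname{core}_V U=\{u\in U: U\cap\,]u,v]\ne\emptyset\ \text{for all } v\in V\}$, where $]u,v]=\{u+t(v-u): t\in\,]0,1]\}$. *)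

theory Defs
  imports "HOL-Analysis.Analysis"
begin

text \<open>Real topological vector spaces (not necessarily Hausdorff; combine with class
  \<^class>\<open>t2_space\<close>). The assumption is joint continuity of scalar multiplication, stated in
  the style of the classes for topological groups.\<close>

class topological_real_vector = topological_ab_group_add + real_vector +
  assumes tendsto_scaleR_nhds:
    "((\<lambda>p. fst p *\<^sub>R snd p) \<longlongrightarrow> a *\<^sub>R x) (nhds (a::real) \<times>\<^sub>F nhds x)"

instance real_normed_vector \<subseteq> topological_real_vector
proof
  fix a :: real and x :: 'a
  show "((\<lambda>p. fst p *\<^sub>R snd p) \<longlongrightarrow> a *\<^sub>R x) (nhds a \<times>\<^sub>F nhds x)"
    by (intro tendsto_scaleR filterlim_fst filterlim_snd)
qed

definition pointed :: "'z::real_vector set \<Rightarrow> bool" where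
  "pointed C \<longleftrightarrow> C \<inter> uminus ` C = {0}"

definition C_convex_on ::
  "'z::real_vector set \<Rightarrow> 'x::real_vector set \<Rightarrow> ('x \<Rightarrow> 'z) \<Rightarrow> bool" where
  "C_convex_on C K f \<longleftrightarrow>
     (\<forall>x\<in>K. \<forall>y\<in>K. \<forall>t\<in>{0..1}.
        t *\<^sub>R f x + (1 - t) *\<^sub>R f y - f (t *\<^sub>R x + (1 - t) *\<^sub>R y) \<in> C)"

text \<open>A neighborhood of a point is any set having the point in its interior.\<close>

definition C_usc_on ::
  "'z::topological_real_vector set \<Rightarrow> 'x::topological_space set \<Rightarrow> ('x \<Rightarrow> 'z) \<Rightarrow> bool" where
  "C_usc_on C K f \<longleftrightarrow>
     (\<forall>x\<in>K. \<forall>V. f x \<in> interior V \<longrightarrow>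
        (\<exists>U. x \<in> interior U \<and> (\<forall>u\<in>U \<inter> K. f u \<in> {v - c |v c. v \<in> V \<and> c \<in> C})))"

definition core_in :: "'x::real_vector set \<Rightarrow> 'x set \<Rightarrow> 'x set" where
  "core_in V U = {u \<in> U. \<forall>v\<in>V. U \<inter> {u + t *\<^sub>R (v - u) |t. t \<in> {0<..1}} \<noteq> {}}"

definition directed_set :: "'i set \<Rightarrow> ('i \<Rightarrow> 'i \<Rightarrow> bool) \<Rightarrow> bool" where
  "directed_set I le \<longleftrightarrow> I \<noteq> {} \<and> (\<forall>i\<in>I. le i i) \<and>
     (\<forall>i\<in>I. \<forall>j\<in>I. \<forall>k\<in>I. le i j \<longrightarrow> le j k \<longrightarrow> le i k) \<and>
     (\<forall>i\<in>I. \<forall>j\<in>I. \<exists>k\<in>I. le i k \<and> le j k)"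

text \<open>A net is a function \<open>x\<close> on a directed set; \<open>x\<close> converges to \<open>l\<close> iff
  \<open>(x \<longlongrightarrow> l) (tails I le)\<close>.\<close>

definition tails :: "'i set \<Rightarrow> ('i \<Rightarrow> 'i \<Rightarrow> bool) \<Rightarrow> 'i filter" where
  "tails I le = (INF i\<in>I. principal {j \<in> I. le i j})"

lemma eventually_tails:
  assumes "directed_set I le"
  shows "eventually P (tails I le) \<longleftrightarrow> (\<exists>i\<in>I. \<forall>j\<in>I. le i j \<longrightarrow> P j)"
proof -
  have "eventually P (tails I le) \<longleftrightarrow> (\<exists>i\<in>I. eventually P (principal {j \<in> I. le i j}))"
    unfolding tails_def
  proof (rule eventually_INF_base)
    show "I \<noteq> {}" using assms by (simp add: directed_set_def)
    fix a b assume ab: "a \<in> I" "b \<in> I"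
    then obtain k where k: "k \<in> I" "le a k" "le b k"
      using assms unfolding directed_set_def by blast
    have "{j \<in> I. le k j} \<subseteq> {j \<in> I. le a j} \<inter> {j \<in> I. le b j}"
      using assms ab k unfolding directed_set_def by blast
    then show "\<exists>x\<in>I. principal {j \<in> I. le x j}
        \<le> inf (principal {j \<in> I. le a j}) (principal {j \<in> I. le b j})"
      using k(1) by auto
  qed
  then show ?thesis by (auto simp: eventually_principal)
qed

text \<open>Two conditions on a map quantify over all nets in \<open>K\<close>. HOL cannot quantify over index types
  inside a formula, so the index type is a parameter. The lemmas at the end show that nets indexed
  by the type \<open>'x set \<times> 'x\<close> already imply the condition for nets over every other index type, so
  this instance is the unrestricted condition.\<close>

definition net_closed_on ::
  "'i itself \<Rightarrow> 'z::topological_real_vector set \<Rightarrow> 'x::topological_space set \<Rightarrow>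
     ('x \<Rightarrow> 'z) \<Rightarrow> bool" where
  "net_closed_on (_ :: 'i itself) C K f \<longleftrightarrow>
     (\<forall>(I :: 'i set) le xs. \<forall>x\<in>K.
        directed_set I le \<longrightarrow> (\<forall>i\<in>I. xs i \<in> K) \<longrightarrow> (xs \<longlongrightarrow> x) (tails I le) \<longrightarrow>
        (\<forall>i\<in>I. f (xs i) \<notin> uminus ` interior C) \<longrightarrow> f x \<notin> uminus ` interior C)"

definition net_usc_on ::
  "'i itself \<Rightarrow> 'z::topological_real_vector set \<Rightarrow> 'x::topological_space set \<Rightarrow>
     ('x \<Rightarrow> 'z) \<Rightarrow> bool" where
  "net_usc_on (_ :: 'i itself) C K f \<longleftrightarrow>
     (\<forall>(I :: 'i set) le xs. \<forall>x\<in>K.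
        directed_set I le \<longrightarrow> (\<forall>i\<in>I. xs i \<in> K) \<longrightarrow> (xs \<longlongrightarrow> x) (tails I le) \<longrightarrow>
        (\<exists>zs z. (zs \<longlongrightarrow> z) (tails I le) \<and>
           (\<forall>i\<in>I. f (xs i) - zs i \<in> uminus ` C) \<and> f x - z \<in> C))"

text \<open>Every net \<open>xs\<close> factors cofinally, via \<open>i \<mapsto> ({xs j |j. i \<le> j}, xs i)\<close>, through a net indexed by
  pairs of a tail and a point of it.\<close>

lemma canonical_net:
  fixes xs :: "'j \<Rightarrow> 'x::topological_space"
  assumes J: "directed_set J le" and lim: "(xs \<longlongrightarrow> x) (tails J le)"
  defines "T \<equiv> \<lambda>k. xs ` {j \<in> J. le k j}"
  defines "I \<equiv> {(T k, u) |k u. k \<in> J \<and> u \<in> T k}"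
  defines "leI \<equiv> \<lambda>p q. fst q \<subseteq> (fst p :: 'x set)"
  shows "directed_set I leI" "(snd \<longlongrightarrow> x) (tails I leI)"
    and "\<And>i. i \<in> I \<Longrightarrow> snd i \<in> xs ` J" "\<And>j. j \<in> J \<Longrightarrow> (T j, xs j) \<in> I"
    and "filterlim (\<lambda>j. (T j, xs j)) (tails I leI) (tails J le)"
proof -
  have T_anti: "T j \<subseteq> T i" if "i \<in> J" "j \<in> J" "le i j" for i j
    using J that unfolding T_def directed_set_def by blast
  have T_self: "xs j \<in> T j" if "j \<in> J" for j
    using J that unfolding T_def directed_set_def by blast
  show mem: "\<And>j. j \<in> J \<Longrightarrow> (T j, xs j) \<in> I"
    using T_self unfolding I_def by blast
  show "\<And>i. i \<in> I \<Longrightarrow> snd i \<in> xs ` J"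
    unfolding I_def T_def by auto
  have ne: "I \<noteq> {}" using J mem unfolding directed_set_def by blast
  have dir: "\<exists>r\<in>I. leI p r \<and> leI q r" if p: "p \<in> I" and q: "q \<in> I" for p q
  proof -
    obtain a b where ab: "a \<in> J" "b \<in> J" "fst p = T a" "fst q = T b"
      using p q unfolding I_def by auto
    then obtain k where k: "k \<in> J" "le a k" "le b k"
      using J unfolding directed_set_def by blast
    have "leI p (T k, xs k) \<and> leI q (T k, xs k)"
      using ab k T_anti unfolding leI_def by auto
    then show ?thesis using mem[OF k(1)] by blast
  qed
  show D: "directed_set I leI"
    unfolding directed_set_def using ne dir by (auto simp: leI_def)
  show "(snd \<longlongrightarrow> x) (tails I leI)"
  proof (rule topological_tendstoI)
    fix S assume "open S" "x \<in> S"
    then have "eventually (\<lambda>j. xs j \<in> S) (tails J le)"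
      using lim by (simp add: topological_tendstoD)
    then obtain k where k: "k \<in> J" "\<forall>j\<in>J. le k j \<longrightarrow> xs j \<in> S"
      unfolding eventually_tails[OF J] by blast
    have "T k \<subseteq> S" using k unfolding T_def by auto
    then have "\<forall>q\<in>I. leI (T k, xs k) q \<longrightarrow> snd q \<in> S"
      unfolding leI_def I_def by auto
    then show "eventually (\<lambda>q. snd q \<in> S) (tails I leI)"
      unfolding eventually_tails[OF D] using mem[OF k(1)] by blast
  qed
  show "filterlim (\<lambda>j. (T j, xs j)) (tails I leI) (tails J le)"
  proof (rule filterlim_iff[THEN iffD2], intro allI impI)
    fix P assume "eventually P (tails I leI)"
    then obtain p where p: "p \<in> I" "\<forall>q\<in>I. leI p q \<longrightarrow> P q"
      unfolding eventually_tails[OF D] by blast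
    obtain k where k: "k \<in> J" "fst p = T k" using p(1) unfolding I_def by auto
    have "P (T j, xs j)" if "j \<in> J" "le k j" for j
      using p(2) mem[OF that(1)] T_anti[OF k(1) that] k(2) unfolding leI_def by auto
    then show "eventually (\<lambda>j. P (T j, xs j)) (tails J le)"
      unfolding eventually_tails[OF J] using k(1) by blast
  qed
qed

lemma net_closed_on_any_index:
  fixes K :: "'x::topological_space set"
  assumes "net_closed_on TYPE('x set \<times> 'x) C K f"
  shows "net_closed_on TYPE('j) C K f"
  unfolding net_closed_on_def
proof (intro allI ballI impI)
  fix J :: "'j set" and le xs x
  assume J: "directed_set J le" "x \<in> K" "\<forall>i\<in>J. xs i \<in> K" "(xs \<longlongrightarrow> x) (tails J le)"
    "\<forall>i\<in>J. f (xs i) \<notin> uminus ` interior C"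
  define T where "T k = xs ` {j \<in> J. le k j}" for k
  let ?I = "{(T k, u) |k u. k \<in> J \<and> u \<in> T k}"
  note N = canonical_net[OF J(1,4), folded T_def]
  show "f x \<notin> uminus ` interior C"
  proof (rule assms[unfolded net_closed_on_def, rule_format, OF J(2) N(1) _ N(2)])
    fix i assume "i \<in> ?I"
    then obtain j where j: "j \<in> J" "snd i = xs j" using N(3) by (meson imageE)
    show "snd i \<in> K" unfolding j(2) by (rule bspec[OF J(3) j(1)])
    show "f (snd i) \<notin> uminus ` interior C" unfolding j(2) by (rule bspec[OF J(5) j(1)])
  qed
qed

lemma net_usc_on_any_index:
  fixes K :: "'x::topological_space set"
  assumes "net_usc_on TYPE('x set \<times> 'x) C K f"
  shows "net_usc_on TYPE('j) C K f"
  unfolding net_usc_on_def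
proof (intro allI ballI impI)
  fix J :: "'j set" and le xs x
  assume J: "directed_set J le" "x \<in> K" "\<forall>i\<in>J. xs i \<in> K" "(xs \<longlongrightarrow> x) (tails J le)"
  define T where "T k = xs ` {j \<in> J. le k j}" for k
  let ?I = "{(T k, u) |k u. k \<in> J \<and> u \<in> T k}"
  let ?le = "\<lambda>p q. fst q \<subseteq> (fst p :: 'x set)"
  note N = canonical_net[OF J(1,4), folded T_def]
  have xs_K: "snd i \<in> K" if i: "i \<in> ?I" for i
  proof -
    obtain j where j: "j \<in> J" "snd i = xs j" using N(3)[OF i] by (meson imageE)
    show ?thesis unfolding j(2) using J(3) j(1) by (rule bspec)
  qed
  have "\<exists>zs z. (zs \<longlongrightarrow> z) (tails ?I ?le) \<and>
      (\<forall>i\<in>?I. f (snd i) - zs i \<in> uminus ` C) \<and> f x - z \<in> C"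
    by (rule assms[unfolded net_usc_on_def, rule_format, OF J(2) N(1) xs_K N(2)])
  then obtain zs z where z: "(zs \<longlongrightarrow> z) (tails ?I ?le)"
    "\<forall>i\<in>?I. f (snd i) - zs i \<in> uminus ` C" "f x - z \<in> C"
    by (elim exE conjE)
  have "((\<lambda>j. zs (T j, xs j)) \<longlongrightarrow> z) (tails J le)"
    using filterlim_compose[OF z(1) N(5)] .
  moreover have "\<forall>i\<in>J. f (xs i) - zs (T i, xs i) \<in> uminus ` C"
  proof
    fix j assume "j \<in> J"
    from bspec[OF z(2) N(4)[OF this]] show "f (xs j) - zs (T j, xs j) \<in> uminus ` C" by simp
  qed
  ultimately show "\<exists>zs z. (zs \<longlongrightarrow> z) (tails J le) \<and>
      (\<forall>i\<in>J. f (xs i) - zs i \<in> uminus ` C) \<and> f x - z \<in> C"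
    using z(3) by (intro exI[of _ "\<lambda>j. zs (T j, xs j)"] exI[of _ z]) blast
qed

end

theory Submission
  imports Defs
begin

text \<open>
  Put \<open>G y = {x \<in> K0. F x y x \<notin> - int C}\<close>. Each of the three alternatives of the continuity
  hypothesis makes \<open>G y\<close> closed: the second and the third one both imply the first, because
  \<open>- int C - C \<subseteq> - int C\<close>, and the first one is closedness along nets. By \<open>C\<close>-convexity the set
  \<open>{y \<in> K0. x \<notin> G y}\<close> of those \<open>y\<close> with \<open>F x y x \<in> - int C\<close> is convex, and it does not contain \<open>x\<close>,
  since \<open>F x x x \<notin> - int C\<close>. The Fan--Browder theorem (\<open>Fan_Browder\<close>) therefore gives
  \<open>x0 \<in> K0\<close> with \<open>F x0 y x0 \<notin> - int C\<close> for all \<open>y \<in> K0\<close>.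

  It remains to pass from \<open>K0\<close> to \<open>K\<close> (\<open>core_in_extends\<close>). There is a point \<open>u\<close> of the core of \<open>K0\<close>
  with \<open>F x0 u x0 \<in> - C\<close>: if \<open>x0\<close> itself is in the core take \<open>u = x0\<close>, and otherwise the coercivity
  hypothesis provides \<open>u\<close>. If some \<open>y \<in> K\<close> had \<open>F x0 y x0 \<in> - int C\<close>, then by \<open>C\<close>-convexity the value
  would lie in \<open>- int C\<close> all along the half-open segment from \<open>u\<close> (excluded) to \<open>y\<close>; but this
  segment meets \<open>K0\<close>.

  The Fan--Browder theorem reduces by compactness to finitely many points, hence to the simplex that
  they span, and there to Brouwer's fixed point theorem. The number of points is not known in
  advance and so cannot be the dimension of a Euclidean space type; for this reason Brouwer's theorem
  is proved for the Hilbert cube in \<open>nat \<Rightarrow> real\<close> (\<open>Brouwer_Hilbert_cube\<close>), which contains the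
  simplices of all dimensions. It follows from Kuhn's combinatorial lemma on \<open>n\<close>-dimensional grids by
  letting dimension and fineness of the grid tend to infinity together.
\<close>

section \<open>Brouwer's theorem for the Hilbert cube\<close>

lemma compact_Hilbert_cube:
  "compact {x :: nat \<Rightarrow> real. \<forall>i. x i \<in> {0..1}}"
proof -
  have "compactin (product_topology (\<lambda>i. euclidean) UNIV) (PiE UNIV (\<lambda>i::nat. {0..1::real}))"
    by (simp add: compactin_PiE)
  moreover have "PiE UNIV (\<lambda>i::nat. {0..1::real}) = {x. \<forall>i. x i \<in> {0..1}}"
    by (auto simp: PiE_def Pi_def)
  ultimately show ?thesis
    by (simp add: euclidean_product_topology)
qed

lemma tendsto_fun_iff:
  fixes f :: "'a \<Rightarrow> 'b \<Rightarrow> 'c::topological_space"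
  shows "(f \<longlongrightarrow> l) F \<longleftrightarrow> (\<forall>i. ((\<lambda>x. f x i) \<longlongrightarrow> l i) F)"
  using limitin_componentwise[of "\<lambda>i::'b. euclidean :: 'c topology" UNIV f l F]
  unfolding euclidean_product_topology limitin_canonical_iff by (simp add: PiE_UNIV_domain)

text \<open>An approximate fixed point: near \<open>q\<close>, each of the first \<open>n\<close> coordinates of \<open>f x - x\<close> is
  nonnegative somewhere and nonpositive somewhere. Kuhn's lemma finds \<open>q\<close> on the grid of mesh
  \<open>1 / (n + 1)\<close> in the face where all coordinates from \<open>n\<close> on vanish, when the grid points are labelled
  in each coordinate by the sign of \<open>f x - x\<close>.\<close>

lemma Hilbert_cube_approx:
  fixes f :: "(nat \<Rightarrow> real) \<Rightarrow> (nat \<Rightarrow> real)"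
  assumes f: "\<And>x i. (\<And>j. x j \<in> {0..1}) \<Longrightarrow> f x i \<in> {0..1}"
  shows "\<exists>q. (\<forall>j. q j \<in> {0..1}) \<and> (\<forall>i<n.
     (\<exists>r. (\<forall>j. r j \<in> {0..1} \<and> \<bar>r j - q j\<bar> \<le> 1 / Suc n) \<and> r i \<le> f r i) \<and>
     (\<exists>r. (\<forall>j. r j \<in> {0..1} \<and> \<bar>r j - q j\<bar> \<le> 1 / Suc n) \<and> f r i \<le> r i))"
proof -
  \<comment> \<open>Grid points are integer vectors; \<open>e\<close> embeds them into the cube.\<close>
  define e :: "(nat \<Rightarrow> nat) \<Rightarrow> nat \<Rightarrow> real" where "e x i = (if i < n then x i / Suc n else 0)" for x i
  \<comment> \<open>A coordinate equal to 1 satisfies both inequalities if \<open>f\<close> fixes it, but Kuhn's lemma requires the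
    label 1 there; hence the first conjunct.\<close>
  define label :: "(nat \<Rightarrow> nat) \<Rightarrow> nat \<Rightarrow> nat"
    where "label x i = (if x i \<noteq> Suc n \<and> e x i \<le> f (e x) i then 0 else 1)" for x i
  have e01: "e x j \<in> {0..1}" if "\<forall>i<n. x i \<le> Suc n" for x j
    using that by (auto simp: e_def divide_simps)
  obtain q where q: "\<forall>i<n. q i < Suc n"
    and label: "\<forall>i<n. \<exists>r s. (\<forall>j<n. q j \<le> r j \<and> r j \<le> q j + 1) \<and>
      (\<forall>j<n. q j \<le> s j \<and> s j \<le> q j + 1) \<and> label r i \<noteq> label s i"
  proof (rule kuhn_lemma[of "Suc n" n label])
    show "\<forall>x. (\<forall>i<n. x i \<le> Suc n) \<longrightarrow> (\<forall>i<n. x i = 0 \<longrightarrow> label x i = 0)"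
      using f e01 by (auto simp: label_def e_def)
  qed (auto simp: label_def)
  have near: "\<bar>e r j - e q j\<bar> \<le> 1 / Suc n" if "\<forall>j<n. q j \<le> r j \<and> r j \<le> q j + 1" for r j
  proof (cases "j < n")
    case True
    then have "real (q j) \<le> r j" "real (r j) \<le> q j + 1" using that by (fastforce)+
    then show ?thesis using True by (simp add: e_def flip: diff_divide_distrib) (simp add: divide_simps)
  qed (simp add: e_def)
  have le: "\<forall>j<n. r j \<le> Suc n" if "\<forall>j<n. q j \<le> r j \<and> r j \<le> q j + 1" for r
    using that q by fastforce
  have lab0: "e x i \<le> f (e x) i" if "label x i = 0" for x i
    using that by (auto simp: label_def split: if_splits)
  have lab1: "f (e x) i \<le> e x i" if "label x i \<noteq> 0" "i < n" "\<forall>j<n. x j \<le> Suc n" for x i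
    using that f[of "e x" i] e01[of x] by (auto simp: label_def e_def split: if_splits)
  have "(\<exists>r. (\<forall>j. r j \<in> {0..1} \<and> \<bar>r j - e q j\<bar> \<le> 1 / Suc n) \<and> r i \<le> f r i) \<and>
     (\<exists>r. (\<forall>j. r j \<in> {0..1} \<and> \<bar>r j - e q j\<bar> \<le> 1 / Suc n) \<and> f r i \<le> r i)"
    if i: "i < n" for i
  proof -
    obtain r s where rs: "\<forall>j<n. q j \<le> r j \<and> r j \<le> q j + 1"
      "\<forall>j<n. q j \<le> s j \<and> s j \<le> q j + 1" "label r i \<noteq> label s i"
      using label i by blast
    consider "label r i = 0" "label s i \<noteq> 0" | "label s i = 0" "label r i \<noteq> 0"
      using rs(3) by (auto simp: label_def split: if_splits)
    then obtain u v where u: "\<forall>j<n. q j \<le> u j \<and> u j \<le> q j + 1" "label u i = 0"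
      and v: "\<forall>j<n. q j \<le> v j \<and> v j \<le> q j + 1" "label v i \<noteq> 0"
      using rs(1,2) by cases blast+
    have "\<exists>r. (\<forall>j. r j \<in> {0..1} \<and> \<bar>r j - e q j\<bar> \<le> 1 / Suc n) \<and> r i \<le> f r i"
      using near[OF u(1)] e01[OF le[OF u(1)]] lab0[OF u(2)] by blast
    moreover have "\<exists>r. (\<forall>j. r j \<in> {0..1} \<and> \<bar>r j - e q j\<bar> \<le> 1 / Suc n) \<and> f r i \<le> r i"
      using near[OF v(1)] e01[OF le[OF v(1)]] lab1[OF v(2) i le[OF v(1)]] by blast
    ultimately show ?thesis ..
  qed
  moreover have "e q j \<in> {0..1}" for j using e01[of q] q by (simp add: less_imp_le)
  ultimately show ?thesis by blast
qed

text \<open>A limit point \<open>x\<close> of the approximate fixed points is fixed: for every coordinate \<open>i\<close>, the nearby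
  points at which \<open>f x - x\<close> has \<open>i\<close>-th coordinate of either sign converge to \<open>x\<close> as well. Convergence is
  coordinatewise, so it is harmless that coordinate \<open>i\<close> is controlled only from dimension \<open>i + 1\<close> on.\<close>

theorem Brouwer_Hilbert_cube:
  fixes f :: "(nat \<Rightarrow> real) \<Rightarrow> (nat \<Rightarrow> real)"
  defines "Q \<equiv> {x :: nat \<Rightarrow> real. \<forall>i. x i \<in> {0..1}}"
  assumes cont: "continuous_on Q f" and f: "f ` Q \<subseteq> Q"
  shows "\<exists>x\<in>Q. f x = x"
proof -
  have "\<forall>n. \<exists>q. (\<forall>j. q j \<in> {0..1}) \<and> (\<forall>i<n.
     (\<exists>r. (\<forall>j. r j \<in> {0..1} \<and> \<bar>r j - q j\<bar> \<le> 1 / Suc n) \<and> r i \<le> f r i) \<and>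
     (\<exists>r. (\<forall>j. r j \<in> {0..1} \<and> \<bar>r j - q j\<bar> \<le> 1 / Suc n) \<and> f r i \<le> r i))"
    using f unfolding Q_def by (intro allI Hilbert_cube_approx) blast
  then obtain q where q: "\<And>n j. q n j \<in> {0..1}" and near:
    "\<And>n i. i < n \<Longrightarrow>
       (\<exists>r. (\<forall>j. r j \<in> {0..1} \<and> \<bar>r j - q n j\<bar> \<le> 1 / Suc n) \<and> r i \<le> f r i) \<and>
       (\<exists>r. (\<forall>j. r j \<in> {0..1} \<and> \<bar>r j - q n j\<bar> \<le> 1 / Suc n) \<and> f r i \<le> r i)"
    by metis
  have "seq_compact Q"
    unfolding Q_def using compact_Hilbert_cube compact_eq_seq_compact_metric by blast
  moreover have "\<forall>n. q n \<in> Q" using q by (auto simp: Q_def)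
  ultimately obtain x h where x: "x \<in> Q" and h: "strict_mono (h :: nat \<Rightarrow> nat)"
    and lim: "(q \<circ> h) \<longlonglongrightarrow> x"
    unfolding seq_compact_def by blast
  have "f x i = x i" for i
  proof -
    have "\<forall>m. \<exists>r. i < h m \<longrightarrow>
        (\<forall>j. r j \<in> {0..1} \<and> \<bar>r j - q (h m) j\<bar> \<le> 1 / Suc (h m)) \<and> r i \<le> f r i"
      using near[THEN conjunct1] by blast
    from choice[OF this] obtain r where r: "\<And>m j. i < h m \<Longrightarrow> r m j \<in> {0..1}"
      "\<And>m j. i < h m \<Longrightarrow> \<bar>r m j - q (h m) j\<bar> \<le> 1 / Suc (h m)"
      "\<And>m. i < h m \<Longrightarrow> r m i \<le> f (r m) i"
      by blast
    have "\<forall>m. \<exists>r. i < h m \<longrightarrow>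
        (\<forall>j. r j \<in> {0..1} \<and> \<bar>r j - q (h m) j\<bar> \<le> 1 / Suc (h m)) \<and> f r i \<le> r i"
      using near[THEN conjunct2] by blast
    from choice[OF this] obtain s where s: "\<And>m j. i < h m \<Longrightarrow> s m j \<in> {0..1}"
      "\<And>m j. i < h m \<Longrightarrow> \<bar>s m j - q (h m) j\<bar> \<le> 1 / Suc (h m)"
      "\<And>m. i < h m \<Longrightarrow> f (s m) i \<le> s m i"
      by blast
    have large: "\<forall>\<^sub>F m in sequentially. i < h m"
      using eventually_compose_filterlim[OF eventually_gt_at_top filterlim_subseq[OF h]] .
    have mesh: "(\<lambda>m. 1 / Suc (h m)) \<longlonglongrightarrow> 0"
      using LIMSEQ_subseq_LIMSEQ[OF LIMSEQ_Suc[OF lim_1_over_n[where 'a=real]] h]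
      by (simp add: o_def)
    have lim_t: "t \<longlonglongrightarrow> x"
      if "\<And>m j. i < h m \<Longrightarrow> \<bar>t m j - q (h m) j\<bar> \<le> 1 / Suc (h m)" for t :: "nat \<Rightarrow> nat \<Rightarrow> real"
      unfolding tendsto_fun_iff
    proof
      fix j
      have "(\<lambda>m. t m j - q (h m) j) \<longlonglongrightarrow> 0"
        by (rule Lim_null_comparison[OF _ mesh]) (use large that in \<open>auto elim: eventually_mono\<close>)
      moreover have "(\<lambda>m. q (h m) j) \<longlonglongrightarrow> x j"
        using lim unfolding tendsto_fun_iff by (simp add: o_def)
      ultimately show "(\<lambda>m. t m j) \<longlonglongrightarrow> x j"
        using tendsto_add by fastforce
    qed
    have lim_f: "(\<lambda>m. f (t m) i) \<longlonglongrightarrow> f x i"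
      if "t \<longlonglongrightarrow> x" "\<And>m j. i < h m \<Longrightarrow> t m j \<in> {0..1}" for t
    proof -
      have "\<forall>\<^sub>F m in sequentially. t m \<in> Q"
        using large by eventually_elim (use that in \<open>auto simp: Q_def\<close>)
      then have "(\<lambda>m. f (t m)) \<longlonglongrightarrow> f x"
        using continuous_on_tendsto_compose[OF cont that(1) x] by simp
      then show ?thesis unfolding tendsto_fun_iff by blast
    qed
    have "x i \<le> f x i"
    proof (rule tendsto_le[OF sequentially_bot])
      show "(\<lambda>m. f (r m) i) \<longlonglongrightarrow> f x i" using lim_f lim_t r by blast
      show "(\<lambda>m. r m i) \<longlonglongrightarrow> x i" using lim_t[of r] r(2) unfolding tendsto_fun_iff by blast
      show "\<forall>\<^sub>F m in sequentially. r m i \<le> f (r m) i" using large r(3) by (auto elim: eventually_mono)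
    qed
    moreover have "f x i \<le> x i"
    proof (rule tendsto_le[OF sequentially_bot])
      show "(\<lambda>m. f (s m) i) \<longlonglongrightarrow> f x i" using lim_f lim_t s by blast
      show "(\<lambda>m. s m i) \<longlonglongrightarrow> x i" using lim_t[of s] s(2) unfolding tendsto_fun_iff by blast
      show "\<forall>\<^sub>F m in sequentially. f (s m) i \<le> s m i" using large s(3) by (auto elim: eventually_mono)
    qed
    ultimately show ?thesis by simp
  qed
  then show ?thesis using x by blast
qed

section \<open>Topological vector spaces\<close>

lemma tendsto_scaleR_topological:
  fixes g :: "'a \<Rightarrow> 'b::topological_real_vector"
  assumes "(f \<longlongrightarrow> a) F" "(g \<longlongrightarrow> x) F"
  shows "((\<lambda>u. f u *\<^sub>R g u) \<longlongrightarrow> a *\<^sub>R x) F"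
  using filterlim_compose[OF tendsto_scaleR_nhds filterlim_Pair[OF assms]] by simp

lemma continuous_on_scaleR_topological:
  fixes g :: "'a::topological_space \<Rightarrow> 'b::topological_real_vector"
  assumes "continuous_on S f" "continuous_on S g"
  shows "continuous_on S (\<lambda>u. f u *\<^sub>R g u)"
  using assms unfolding continuous_on_def by (blast intro: tendsto_scaleR_topological)

lemma open_uminus_image:
  fixes S :: "'a::topological_ab_group_add set"
  assumes "open S"
  shows "open (uminus ` S)"
proof -
  have "uminus ` S = uminus -` S" by force
  then show ?thesis using assms by (simp add: open_vimage continuous_on_minus)
qed

text \<open>The translate of the interior of \<open>C\<close> by \<open>c\<close> is open and contained in \<open>C + C = C\<close>.\<close>

lemma interior_cone_plus:
  fixes C :: "'z::topological_real_vector set"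
  assumes "C + C = C" "a \<in> interior C" "c \<in> C"
  shows "a + c \<in> interior C"
proof (rule interiorI)
  show "open ((\<lambda>z. z - c) -` interior C)"
    by (intro open_vimage) (auto intro!: continuous_intros)
  show "(\<lambda>z. z - c) -` interior C \<subseteq> C"
  proof
    fix z assume "z \<in> (\<lambda>z. z - c) -` interior C"
    then have "(z - c) + c \<in> C + C"
      using interior_subset assms(3) by (intro set_plus_intro) auto
    then show "z \<in> C" using assms(1) by simp
  qed
qed (use assms in simp)

lemma interior_cone_scaleR:
  fixes C :: "'z::topological_real_vector set"
  assumes "cone C" "a \<in> interior C" "0 < t"
  shows "t *\<^sub>R a \<in> interior C"
proof (rule interiorI)
  show "open ((\<lambda>z. inverse t *\<^sub>R z) -` interior C)"
    by (intro open_vimage continuous_on_scaleR_topological) auto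
  show "(\<lambda>z. inverse t *\<^sub>R z) -` interior C \<subseteq> C"
  proof
    fix z assume "z \<in> (\<lambda>z. inverse t *\<^sub>R z) -` interior C"
    then have "t *\<^sub>R (inverse t *\<^sub>R z) \<in> C"
      using assms(1,3) interior_subset unfolding cone_def by (metis less_imp_le subsetD vimageE)
    then show "z \<in> C" using assms(3) by simp
  qed
qed (use assms in simp)

lemma neg_interior_cone_minus:
  fixes C :: "'z::topological_real_vector set"
  assumes "C + C = C" "a \<in> uminus ` interior C" "c \<in> C"
  shows "a - c \<in> uminus ` interior C"
proof -
  have "- a + c \<in> interior C" using assms by (intro interior_cone_plus) auto
  then show ?thesis by (intro image_eqI[of _ _ "- a + c"]) auto
qed

lemma neg_interior_cone_combination:
  fixes C :: "'z::topological_real_vector set"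
  assumes "cone C" "C + C = C" "a \<in> uminus ` interior C" "c \<in> uminus ` C" "0 < t" "t \<le> 1"
  shows "t *\<^sub>R a + (1 - t) *\<^sub>R c \<in> uminus ` interior C"
proof -
  have "t *\<^sub>R a \<in> uminus ` interior C"
    using assms(1,3,5) interior_cone_scaleR by fastforce
  moreover have "(1 - t) *\<^sub>R (- c) \<in> C"
    using assms(1,4,6) unfolding cone_def by fastforce
  ultimately have "t *\<^sub>R a - (1 - t) *\<^sub>R (- c) \<in> uminus ` interior C"
    by (rule neg_interior_cone_minus[OF assms(2)])
  then show ?thesis by simp
qed

section \<open>The Fan--Browder theorem\<close>

text \<open>A retraction of the cube onto the standard simplex: adding the defect \<open>\<bar>1 - \<Sum> s\<bar>\<close> to all coordinates
  changes nothing on the simplex and makes the sum positive elsewhere, so that one may normalise.\<close>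

definition cube_to_simplex :: "nat \<Rightarrow> (nat \<Rightarrow> real) \<Rightarrow> nat \<Rightarrow> real" where
  "cube_to_simplex n s i =
     (s i + \<bar>1 - (\<Sum>j<n. s j)\<bar>) / (\<Sum>j<n. s j + \<bar>1 - (\<Sum>j<n. s j)\<bar>)"

lemma cube_to_simplex_denominator:
  fixes s :: "nat \<Rightarrow> real"
  assumes "0 < n" "\<And>j. j < n \<Longrightarrow> 0 \<le> s j"
  shows "0 < (\<Sum>j<n. s j + \<bar>1 - (\<Sum>j<n. s j)\<bar>)"
proof (cases "(\<Sum>j<n. s j) = 1")
  case False
  then show ?thesis using assms by (intro sum_pos) (auto simp: add_nonneg_pos)
qed simp

lemma cube_to_simplex:
  assumes "0 < n" "\<And>j. j < n \<Longrightarrow> 0 \<le> s j"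
  shows "i < n \<Longrightarrow> 0 \<le> cube_to_simplex n s i" "(\<Sum>i<n. cube_to_simplex n s i) = 1"
proof -
  have pos: "0 < (\<Sum>j<n. s j + \<bar>1 - (\<Sum>j<n. s j)\<bar>)"
    using assms by (rule cube_to_simplex_denominator)
  show "0 \<le> cube_to_simplex n s i" if "i < n"
    unfolding cube_to_simplex_def using pos assms(2)[OF that] by (intro divide_nonneg_pos) auto
  show "(\<Sum>i<n. cube_to_simplex n s i) = 1"
    unfolding cube_to_simplex_def sum_divide_distrib[symmetric] using pos by simp
qed

lemma cube_to_simplex_id: "(\<Sum>j<n. s j) = 1 \<Longrightarrow> cube_to_simplex n s i = s i"
  by (simp add: cube_to_simplex_def)

text \<open>Suppose that no point of \<open>S\<close> is in all \<open>G (y i)\<close>. Map barycentric coordinates \<open>t\<close>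
  to the normalised vector of distances \<open>d i t\<close> of \<open>t\<close> from the preimage of \<open>G (y i)\<close>. At a fixed
  point \<open>s\<close>, with \<open>x = \<Sum> s i y i\<close>, every \<open>i\<close> with \<open>s i \<noteq> 0\<close> has \<open>x \<notin> G (y i)\<close>; so \<open>x\<close> is a convex combination of
  points of the convex set \<open>{v. x \<notin> G v}\<close> and lies in it, contradicting \<open>x \<in> G x\<close>.\<close>

lemma finite_Fan_Browder:
  fixes y :: "nat \<Rightarrow> 'x::topological_real_vector" and G :: "'x \<Rightarrow> 'x set"
  assumes "convex S" and n: "0 < n" and yS: "\<And>i. i < n \<Longrightarrow> y i \<in> S"
    and clo: "\<And>v. v \<in> S \<Longrightarrow> closed (G v)"
    and self: "\<And>v. v \<in> S \<Longrightarrow> v \<in> G v"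
    and cvx: "\<And>x. x \<in> S \<Longrightarrow> convex {v \<in> S. x \<notin> G v}"
  shows "\<exists>x\<in>S. \<forall>i<n. x \<in> G (y i)"
proof (rule ccontr)
  assume none: "\<not> ?thesis"
  define Q where "Q = {x :: nat \<Rightarrow> real. \<forall>i. x i \<in> {0..1}}"
  define \<phi> where "\<phi> t = (\<Sum>i<n. t i *\<^sub>R y i)" for t
  define d where "d i t = infdist t (\<phi> -` G (y i))" for i t
  define \<rho> where "\<rho> = cube_to_simplex n"
  define f where "f s i = (if i < n then d i (\<rho> s) / (\<Sum>j<n. d j (\<rho> s)) else 0)" for s i
  have cont_coord: "continuous_on A (\<lambda>t::nat \<Rightarrow> real. t i)" for A i
    by (rule continuous_on_product_then_coordinatewise[OF continuous_on_id])
  have cont_\<phi>: "continuous_on UNIV \<phi>"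
    unfolding \<phi>_def by (intro continuous_on_sum continuous_on_scaleR_topological cont_coord) auto
  have d_nonneg: "0 \<le> d i t" for i t unfolding d_def by (rule infdist_nonneg)
  \<comment> \<open>The \<open>i\<close>-th vertex lies in the \<open>i\<close>-th preimage. This matters, as the distance from the empty set
    is 0 by convention.\<close>
  have d_zero: "\<phi> t \<in> G (y i)" if "d i t = 0" "i < n" for i t
  proof -
    have "\<phi> (\<lambda>j. if j = i then 1 else 0) = y i"
      using that(2) by (simp add: \<phi>_def if_distrib[of "\<lambda>r. r *\<^sub>R _"] cong: if_cong)
    then have "\<phi> -` G (y i) \<noteq> {}" using self[OF yS[OF that(2)]] by force
    moreover have "closed (\<phi> -` G (y i))"
      using clo[OF yS[OF that(2)]] cont_\<phi> by (simp add: closed_vimage)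
    ultimately show ?thesis
      using that(1) in_closed_iff_infdist_zero[of "\<phi> -` G (y i)" t] by (simp add: d_def)
  qed
  have \<rho>: "0 \<le> \<rho> s i" "(\<Sum>i<n. \<rho> s i) = 1" if "s \<in> Q" "i < n" for s i
    using that cube_to_simplex[OF n, of s] by (auto simp: Q_def \<rho>_def)
  have \<phi>S: "\<phi> (\<rho> s) \<in> S" if "s \<in> Q" for s
    unfolding \<phi>_def using \<rho>[OF that] n yS by (intro convex_sum assms(1)) auto
  have d_pos: "0 < (\<Sum>j<n. d j (\<rho> s))" if "s \<in> Q" for s
  proof -
    have "\<phi> (\<rho> s) \<in> S" using that by (rule \<phi>S)
    then obtain i where "i < n" "\<phi> (\<rho> s) \<notin> G (y i)" using none by blast
    then have "0 < d i (\<rho> s)" using d_zero d_nonneg by (metis order_le_less)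
    then show ?thesis using \<open>i < n\<close> d_nonneg by (intro sum_pos2[of _ i]) auto
  qed
  have cont_\<rho>: "continuous_on Q \<rho>"
  proof (rule continuous_on_coordinatewise_then_product)
    fix i
    have "(\<Sum>j<n. s j + \<bar>1 - (\<Sum>j<n. s j)\<bar>) \<noteq> 0" if "s \<in> Q" for s
      using cube_to_simplex_denominator[OF n, of s] that by (auto simp: Q_def)
    then show "continuous_on Q (\<lambda>s. \<rho> s i)"
      unfolding \<rho>_def cube_to_simplex_def
      by (intro continuous_intros cont_coord) auto
  qed
  have cont_f: "continuous_on Q f"
  proof (rule continuous_on_coordinatewise_then_product)
    fix i
    have "continuous_on Q (\<lambda>s. d j (\<rho> s))" for j
      unfolding d_def by (intro continuous_intros cont_\<rho>)
    then show "continuous_on Q (\<lambda>s. f s i)"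
      using d_pos by (cases "i < n") (fastforce simp: f_def intro!: continuous_intros)+
  qed
  have sum_f: "(\<Sum>i<n. f s i) = 1" if "s \<in> Q" for s
    using d_pos[OF that] by (simp add: f_def flip: sum_divide_distrib)
  have "f ` Q \<subseteq> Q"
  proof (clarify)
    fix s assume s: "s \<in> Q"
    have "0 \<le> f s i" for i using d_nonneg by (simp add: f_def sum_nonneg)
    moreover have "f s i \<le> 1" for i
    proof (cases "i < n")
      case True
      then have "f s i \<le> (\<Sum>i<n. f s i)"
        using \<open>\<And>i. 0 \<le> f s i\<close> by (intro member_le_sum) auto
      then show ?thesis using sum_f[OF s] by simp
    qed (simp add: f_def)
    ultimately show "f s \<in> Q" by (simp add: Q_def)
  qed
  then obtain s where s: "s \<in> Q" "f s = s"
    using Brouwer_Hilbert_cube cont_f unfolding Q_def by blast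
  have \<rho>s: "\<rho> s = s"
    using sum_f[OF s(1)] s(2) by (auto simp: \<rho>_def cube_to_simplex_id)
  define x where "x = \<phi> s"
  have xS: "x \<in> S" using \<phi>S[OF s(1)] \<rho>s by (simp add: x_def)
  define J where "J = {i \<in> {..<n}. s i \<noteq> 0}"
  have avoid: "y i \<in> {v \<in> S. x \<notin> G v}" if "i \<in> J" for i
  proof -
    have "i < n" "f s i \<noteq> 0" using that s(2) by (auto simp: J_def)
    then have "d i s \<noteq> 0" by (auto simp: f_def \<rho>s)
    moreover have "d i s = 0" if "x \<in> G (y i)"
      using that by (simp add: d_def x_def)
    ultimately show ?thesis using yS[OF \<open>i < n\<close>] by blast
  qed
  have "(\<Sum>i\<in>J. s i) = (\<Sum>i<n. s i)" "x = (\<Sum>i\<in>J. s i *\<^sub>R y i)"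
    unfolding J_def x_def \<phi>_def
    by (rule sum.mono_neutral_left sum.mono_neutral_right; auto)+
  moreover have "(\<Sum>i\<in>J. s i *\<^sub>R y i) \<in> {v \<in> S. x \<notin> G v}"
    using calculation(1) sum_f[OF s(1)] s avoid
    by (intro convex_sum cvx xS) (auto simp: J_def Q_def)
  ultimately have "x \<notin> G x" by simp
  then show False using self[OF xS] by blast
qed

text \<open>The dual form of the Fan--Browder fixed point theorem: a set-valued map \<open>x \<mapsto> {v \<in> S. x \<notin> G v}\<close> with
  convex values and open fibres but without a fixed point must have an empty value.\<close>

theorem Fan_Browder:
  fixes S :: "'x::{topological_real_vector, t2_space} set" and G :: "'x \<Rightarrow> 'x set"
  assumes "compact S" "convex S" "S \<noteq> {}"
    and clo: "\<And>v. v \<in> S \<Longrightarrow> closed (G v)"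
    and self: "\<And>v. v \<in> S \<Longrightarrow> v \<in> G v"
    and cvx: "\<And>x. x \<in> S \<Longrightarrow> convex {v \<in> S. x \<notin> G v}"
  shows "\<exists>x\<in>S. \<forall>v\<in>S. x \<in> G v"
proof -
  have "S \<inter> \<Inter>(G ` S) \<noteq> {}"
  proof (rule compact_imp_fip[OF assms(1)])
    fix \<F> assume "finite \<F>" "\<F> \<subseteq> G ` S"
    then obtain V where V: "V \<subseteq> S" "finite V" "\<F> = G ` V"
      using finite_subset_image by metis
    show "S \<inter> \<Inter>\<F> \<noteq> {}"
    proof (cases "V = {}")
      case False
      obtain n and y :: "nat \<Rightarrow> 'x" where y: "V = y ` {i. i < n}"
        using V(2) finite_imp_nat_seg_image_inj_on by metis
      then have "0 < n" using False by (cases n) auto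
      then have "\<exists>x\<in>S. \<forall>i<n. x \<in> G (y i)"
        using V(1) y by (intro finite_Fan_Browder assms) auto
      then show ?thesis using V(3) y by auto
    qed (use V assms(3) in auto)
  qed (use clo in auto)
  then show ?thesis by blast
qed

section \<open>Nets and upper semicontinuity\<close>

lemma eventually_tails_imp_ex:
  assumes "directed_set I le" "eventually P (tails I le)"
  shows "\<exists>i\<in>I. P i"
proof -
  obtain i where "i \<in> I" "\<forall>j\<in>I. le i j \<longrightarrow> P j"
    using assms(2) unfolding eventually_tails[OF assms(1)] by blast
  moreover have "le i i" using assms(1) \<open>i \<in> I\<close> by (simp add: directed_set_def)
  ultimately show ?thesis by blast
qed

text \<open>The index of this net records the neighbourhood besides the chosen point, so no choice function
  is needed; its index type is the one for which the net conditions are formulated.\<close>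

lemma closure_imp_net:
  fixes S :: "'x::topological_space set"
  assumes "x \<in> closure S"
  obtains I :: "('x set \<times> 'x) set" and le
    where "directed_set I le" "\<forall>i\<in>I. snd i \<in> S" "(snd \<longlongrightarrow> x) (tails I le)"
proof -
  define I where "I = {(U, u). open U \<and> x \<in> U \<and> u \<in> U \<inter> S}"
  define le where "le p q \<longleftrightarrow> fst q \<subseteq> fst p" for p q :: "'x set \<times> 'x"
  have pick: "\<exists>u. (U, u) \<in> I" if "open U" "x \<in> U" for U
    using assms that unfolding closure_iff_nhds_not_empty I_def by fastforce
  have D: "directed_set I le"
    unfolding directed_set_def
  proof (intro conjI ballI impI)
    show "I \<noteq> {}" using pick[of UNIV] by auto
    fix p q assume "p \<in> I" "q \<in> I"
    then have "open (fst p \<inter> fst q)" "x \<in> fst p \<inter> fst q" by (auto simp: I_def)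
    then obtain u where "(fst p \<inter> fst q, u) \<in> I" using pick by blast
    then show "\<exists>r\<in>I. le p r \<and> le q r" by (intro bexI[of _ "(fst p \<inter> fst q, u)"]) (auto simp: le_def)
  qed (auto simp: le_def)
  moreover have "(snd \<longlongrightarrow> x) (tails I le)"
  proof (rule topological_tendstoI)
    fix U assume "open U" "x \<in> U"
    then obtain u where "(U, u) \<in> I" using pick by blast
    then show "\<forall>\<^sub>F i in tails I le. snd i \<in> U"
      unfolding eventually_tails[OF D] by (intro bexI[of _ "(U, u)"]) (auto simp: le_def I_def)
  qed
  ultimately show ?thesis using that[of I le] by (auto simp: I_def)
qed

lemma net_closed_on_imp_closed:
  fixes f :: "'x::topological_space \<Rightarrow> 'z::topological_real_vector"
  assumes "net_closed_on TYPE('x set \<times> 'x) C K f" "closed S" "S \<subseteq> K"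
  shows "closed {x \<in> S. f x \<notin> uminus ` interior C}"
proof -
  let ?G = "{x \<in> S. f x \<notin> uminus ` interior C}"
  have "x \<in> ?G" if x: "x \<in> closure ?G" for x
  proof -
    obtain I :: "('x set \<times> 'x) set" and le
      where net: "directed_set I le" "\<forall>i\<in>I. snd i \<in> ?G" "(snd \<longlongrightarrow> x) (tails I le)"
      by (rule closure_imp_net[OF x]) blast
    have "x \<in> S" using x closure_minimal[of ?G S] assms(2) by blast
    moreover have "f x \<notin> uminus ` interior C"
      by (rule assms(1)[unfolded net_closed_on_def, rule_format, OF _ net(1) _ net(3)])
         (use net(2) \<open>x \<in> S\<close> assms(3) in auto)
    ultimately show ?thesis by blast
  qed
  then show ?thesis using closure_subset_eq by blast
qed

lemma C_usc_on_imp_net_closed_on: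
  fixes C :: "'z::topological_real_vector set"
  assumes "C + C = C" "C_usc_on C K f"
  shows "net_closed_on TYPE('i) C K f"
  unfolding net_closed_on_def
proof (intro allI ballI impI notI)
  fix I :: "'i set" and le xs x
  assume net: "x \<in> K" "directed_set I le" "\<forall>i\<in>I. xs i \<in> K" "(xs \<longlongrightarrow> x) (tails I le)"
    and avoid: "\<forall>i\<in>I. f (xs i) \<notin> uminus ` interior C" and fx: "f x \<in> uminus ` interior C"
  have "f x \<in> interior (uminus ` interior C)"
    using fx by (simp add: interior_open open_uminus_image)
  then obtain U where U: "x \<in> interior U"
    "\<forall>u\<in>U \<inter> K. f u \<in> {v - c |v c. v \<in> uminus ` interior C \<and> c \<in> C}"
    using assms(2) net(1) unfolding C_usc_on_def by meson
  have "\<forall>\<^sub>F i in tails I le. xs i \<in> interior U"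
    using net(4) U(1) by (simp add: topological_tendstoD)
  from eventually_tails_imp_ex[OF net(2) this]
  obtain i where i: "i \<in> I" "xs i \<in> U"
    using interior_subset by blast
  then obtain v c where "f (xs i) = v - c" "v \<in> uminus ` interior C" "c \<in> C"
    using U(2) net(3) by blast
  then have "f (xs i) \<in> uminus ` interior C"
    using neg_interior_cone_minus[OF assms(1)] by simp
  then show False using avoid i(1) by blast
qed

lemma net_usc_on_imp_net_closed_on:
  fixes C :: "'z::topological_real_vector set"
  assumes "C + C = C" "net_usc_on TYPE('i) C K f"
  shows "net_closed_on TYPE('i) C K f"
  unfolding net_closed_on_def
proof (intro allI ballI impI notI)
  fix I :: "'i set" and le xs x
  assume net: "x \<in> K" "directed_set I le" "\<forall>i\<in>I. xs i \<in> K" "(xs \<longlongrightarrow> x) (tails I le)"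
    and avoid: "\<forall>i\<in>I. f (xs i) \<notin> uminus ` interior C" and fx: "f x \<in> uminus ` interior C"
  obtain zs z where z: "(zs \<longlongrightarrow> z) (tails I le)"
    "\<forall>i\<in>I. f (xs i) - zs i \<in> uminus ` C" "f x - z \<in> C"
    using assms(2)[unfolded net_usc_on_def, rule_format, of x I le xs] net by blast
  have "z \<in> uminus ` interior C"
    using neg_interior_cone_minus[OF assms(1) fx z(3)] by simp
  then have "\<forall>\<^sub>F i in tails I le. zs i \<in> uminus ` interior C"
    using z(1) by (simp add: topological_tendstoD open_uminus_image)
  from eventually_tails_imp_ex[OF net(2) this]
  obtain i where i: "i \<in> I" "zs i \<in> uminus ` interior C"
    by blast
  obtain c where c: "c \<in> C" "f (xs i) - zs i = - c" using z(2) i(1) by blast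
  have "f (xs i) = zs i - c" using c(2) by (metis diff_conv_add_uminus diff_add_cancel add.commute)
  then have "f (xs i) \<in> uminus ` interior C"
    using neg_interior_cone_minus[OF assms(1) i(2) c(1)] by simp
  then show False using avoid i(1) by blast
qed

section \<open>The equilibrium problem\<close>

text \<open>A \<open>C\<close>-convex map that is strictly negative at one end of a segment and weakly negative at the
  other is strictly negative on the whole segment, the latter end excluded. Both the convexity of strict
  sublevel sets and the extension from the core rest on this.\<close>

lemma C_convex_on_neg_interior:
  fixes C :: "'z::topological_real_vector set"
  assumes "cone C" "C + C = C" "C_convex_on C K f" "x \<in> K" "y \<in> K"
    "f x \<in> uminus ` interior C" "f y \<in> uminus ` C" "0 < t" "t \<le> 1"
  shows "f (t *\<^sub>R x + (1 - t) *\<^sub>R y) \<in> uminus ` interior C"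
proof -
  let ?w = "t *\<^sub>R f x + (1 - t) *\<^sub>R f y"
  have "?w \<in> uminus ` interior C"
    using neg_interior_cone_combination[OF assms(1,2,6-9)] .
  moreover have "?w - f (t *\<^sub>R x + (1 - t) *\<^sub>R y) \<in> C"
    using assms(3-5,8,9) unfolding C_convex_on_def by auto
  ultimately have "?w - (?w - f (t *\<^sub>R x + (1 - t) *\<^sub>R y)) \<in> uminus ` interior C"
    by (rule neg_interior_cone_minus[OF assms(2)])
  then show ?thesis by simp
qed

lemma convex_strict_sublevel:
  fixes C :: "'z::topological_real_vector set"
  assumes "cone C" "C + C = C" "C_convex_on C K f" "convex S" "S \<subseteq> K"
  shows "convex {v \<in> S. f v \<in> uminus ` interior C}"
  unfolding convex_alt
proof (intro ballI allI impI)
  fix v w and u :: real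
  assume vw: "v \<in> {v \<in> S. f v \<in> uminus ` interior C}" "w \<in> {v \<in> S. f v \<in> uminus ` interior C}"
    and u: "0 \<le> u \<and> u \<le> 1"
  have S: "(1 - u) *\<^sub>R v + u *\<^sub>R w \<in> S"
    using assms(4) vw u by (simp add: convex_alt)
  have "f (u *\<^sub>R w + (1 - u) *\<^sub>R v) \<in> uminus ` interior C"
  proof (cases "u = 0")
    case False
    then show ?thesis
      using vw u assms(5) interior_subset
      by (intro C_convex_on_neg_interior[OF assms(1-3)]) auto
  qed (use vw in simp)
  then show "(1 - u) *\<^sub>R v + u *\<^sub>R w \<in> {v \<in> S. f v \<in> uminus ` interior C}"
    using S by (simp add: add.commute)
qed

text \<open>From a core point \<open>u\<close> one stays in \<open>S\<close> for a positive time in the direction of any \<open>y \<in> K\<close>; a strictly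
  negative value at \<open>y\<close> would therefore force one at a point of \<open>S\<close>.\<close>

lemma core_in_extends:
  fixes C :: "'z::topological_real_vector set"
  assumes "cone C" "C + C = C" "C_convex_on C K f" "S \<subseteq> K"
    and sol: "\<And>v. v \<in> S \<Longrightarrow> f v \<notin> uminus ` interior C"
    and u: "u \<in> core_in K S" "f u \<in> uminus ` C" and "y \<in> K"
  shows "f y \<notin> uminus ` interior C"
proof
  assume fy: "f y \<in> uminus ` interior C"
  have "u \<in> K" using u(1) assms(4) by (auto simp: core_in_def)
  obtain t where t: "0 < t" "t \<le> 1" "u + t *\<^sub>R (y - u) \<in> S"
    using u(1) \<open>y \<in> K\<close> unfolding core_in_def by fastforce
  have "u + t *\<^sub>R (y - u) = t *\<^sub>R y + (1 - t) *\<^sub>R u" by (simp add: algebra_simps)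
  then show False
    using C_convex_on_neg_interior[OF assms(1-3) \<open>y \<in> K\<close> \<open>u \<in> K\<close> fy u(2) t(1,2)] sol[OF t(3)]
    by simp
qed

theorem theorem3p9:
  fixes C :: "'z::{topological_real_vector, t2_space} set"
    and K :: "'x::{topological_real_vector, t2_space} set"
    and F :: "'x \<Rightarrow> 'x \<Rightarrow> 'x \<Rightarrow> 'z"
  assumes "cone C" and "C + C = C" and "pointed C" and "interior C \<noteq> {}"
    and "K \<noteq> {}" and "convex K"
    and "\<forall>y\<in>K. net_closed_on TYPE('x set \<times> 'x) C K (\<lambda>x. F x y x)
               \<or> C_usc_on C K (\<lambda>x. F x y x)
               \<or> net_usc_on TYPE('x set \<times> 'x) C K (\<lambda>x. F x y x)"
    and "\<forall>x\<in>K. C_convex_on C K (\<lambda>y. F x y x)"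
    and "\<forall>x\<in>K. F x x x \<in> uminus ` C - uminus ` interior C"
    and "\<exists>K0. K0 \<noteq> {} \<and> compact K0 \<and> convex K0 \<and> K0 \<subseteq> K \<and>
           (\<forall>x\<in>K0 - core_in K K0. \<exists>y0\<in>core_in K K0. F x y0 x \<in> uminus ` C)"
  shows "\<exists>x0\<in>K. \<forall>y\<in>K. F x0 y x0 \<notin> uminus ` interior C"
proof -
  obtain K0 where K0: "K0 \<noteq> {}" "compact K0" "convex K0" "K0 \<subseteq> K"
    and coercive: "\<And>x. x \<in> K0 - core_in K K0 \<Longrightarrow> \<exists>y0\<in>core_in K K0. F x y0 x \<in> uminus ` C"
    using assms(10) by metis
  define G where "G y = {x \<in> K0. F x y x \<notin> uminus ` interior C}" for y
  have "\<exists>x\<in>K0. \<forall>y\<in>K0. x \<in> G y"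
  proof (rule Fan_Browder[OF K0(2,3,1)])
    fix y assume y: "y \<in> K0"
    then have "net_closed_on TYPE('x set \<times> 'x) C K (\<lambda>x. F x y x)"
      using assms(7) K0(4) C_usc_on_imp_net_closed_on[OF assms(2)]
        net_usc_on_imp_net_closed_on[OF assms(2)] by blast
    then show "closed (G y)"
      unfolding G_def using K0(2,4) by (intro net_closed_on_imp_closed compact_imp_closed)
    show "y \<in> G y" using y K0(4) assms(9) by (auto simp: G_def)
  next
    fix x assume x: "x \<in> K0"
    then have "convex {v \<in> K0. F x v x \<in> uminus ` interior C}"
      using assms(8) K0(4) by (intro convex_strict_sublevel[OF assms(1,2) _ K0(3,4)]) blast
    then show "convex {v \<in> K0. x \<notin> G v}" using x by (simp add: G_def)
  qed
  then obtain x0 where x0: "x0 \<in> K0" "\<And>y. y \<in> K0 \<Longrightarrow> F x0 y x0 \<notin> uminus ` interior C"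
    unfolding G_def by blast
  have x0K: "x0 \<in> K" using x0(1) K0(4) by blast
  have "\<exists>u\<in>core_in K K0. F x0 u x0 \<in> uminus ` C"
  proof (cases "x0 \<in> core_in K K0")
    case True
    then show ?thesis using assms(9) x0K by blast
  next
    case False
    then show ?thesis using coercive x0(1) by blast
  qed
  then obtain u where u: "u \<in> core_in K K0" "F x0 u x0 \<in> uminus ` C" by blast
  have "F x0 y x0 \<notin> uminus ` interior C" if "y \<in> K" for y
    by (rule core_in_extends[where f = "\<lambda>y. F x0 y x0" and S = K0])
       (use assms(1,2,8) K0(4) x0 x0K u that in auto)
  then show ?thesis using x0K by blast
qed

end
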